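(* Let $\triangle$ be a simplicial complex on a finite vertex set $V=[n]$. For any face $F\in\triangle$ there is an isomorphism of binoids \[ (M_\triangle)_{x_F}\cong M_{\triangle'}\wedge(\mathbb Z^F)^\infty, \] where $\triangle'=\operatorname{lk}_\triangle(F)$.
   Context: A simplicial complex $\triangle$ on $V=[n]$ is a collection of subsets (faces) of $V$ closed under taking subsets; all singletons are assumed to be faces. The link of a face $F$ is $\operatorname{lk}_\triangle(F)=\{G\in\triangle\mid F\cup G\in\triangle,\ F\cap G=\varnothing\}$, a simplicial complex on its set of vertices $\{v\in V\smallsetminus F\mid F\cup\{v\}\in\triangle\}$. A (commutative) binoid is a commutative monoid $(M,+,0)$ with an absorbing element $\infty$. The simplicial binoid $M_\triangle$ of a simplicial complex is the binoid generated by variables $x_i$, one for each vertex $i$, with relations $x_{i_1}+\dots+x_{i_k}=\infty$ for every set of vertices $\{i_1,\dots,i_k\}$ that is not a face; $M_{\{\varnothing\}}=\{0,\infty\}$. $(M_\triangle)_{x_F}$ is the localization of $M_\triangle$ at the element $\sum_{i\in F}x_i$ (i.e. all $x_i$, $i\in F$, are made invertible). $\mathbb Z^F$ is the free abelian group of maps $F\to\mathbb Z$, and $N^\infty=N\cup\{\infty\}$ for a monoid $N$ is the binoid obtained by adjoining an absorbing element. The smash product $M\wedge N$ of binoids is $M\times N$ with all pairs having at least one entry equal to $\infty$ identified to a single element $\infty$, with componentwise addition. *)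

theory Defs
  imports "HOL-Library.Multiset" "HOL-Algebra.FiniteProduct" "HOL-Algebra.Product_Groups"
begin

section \<open>Binoids\<close>

text \<open>Binoids extend the monoid records of HOL-Algebra and are hence written multiplicatively:
  \<^term>\<open>mult\<close> and \<^term>\<open>one\<close> are the addition and the neutral element 0 of the additive
  notation, and powers are multiples.\<close>

record 'a binoid = "'a monoid" +
  absorbing :: 'a

locale binoid = comm_monoid M for M :: "('a, 'm) binoid_scheme" (structure) +
  assumes absorbing_closed [simp, intro]: "absorbing M \<in> carrier M"
    and absorbing_mult [simp]: "x \<in> carrier M \<Longrightarrow> absorbing M \<otimes> x = absorbing M"

definition binoid_iso :: "('a, 'm) binoid_scheme \<Rightarrow> ('b, 'n) binoid_scheme \<Rightarrow> ('a \<Rightarrow> 'b) set" where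
  "binoid_iso M N =
    {h \<in> iso M N. h \<one>\<^bsub>M\<^esub> = \<one>\<^bsub>N\<^esub> \<and> h (absorbing M) = absorbing N}"

definition binoid_isomorphic :: "('a, 'm) binoid_scheme \<Rightarrow> ('b, 'n) binoid_scheme \<Rightarrow> bool"
    (infixr \<open>\<cong>\<^sub>b\<close> 60) where
  "M \<cong>\<^sub>b N \<longleftrightarrow> binoid_iso M N \<noteq> {}"

text \<open>The binoid \<open>N\<^sup>\<infinity>\<close>; the adjoined absorbing element is \<^term>\<open>None\<close>.\<close>

definition adjoin_absorbing :: "('a, 'm) monoid_scheme \<Rightarrow> 'a option binoid" where
  "adjoin_absorbing N =
    \<lparr>carrier = insert None (Some ` carrier N),
     mult = (\<lambda>x y. case (x, y) of (Some a, Some b) \<Rightarrow> Some (a \<otimes>\<^bsub>N\<^esub> b) | _ \<Rightarrow> None),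
     one = Some \<one>\<^bsub>N\<^esub>,
     absorbing = None\<rparr>"

subsection \<open>Congruences and quotients\<close>

definition congruence :: "('a, 'm) monoid_scheme \<Rightarrow> 'a rel \<Rightarrow> bool" where
  "congruence M r \<longleftrightarrow> equiv (carrier M) r \<and>
    (\<forall>a b c d. (a, b) \<in> r \<longrightarrow> (c, d) \<in> r \<longrightarrow> (a \<otimes>\<^bsub>M\<^esub> c, b \<otimes>\<^bsub>M\<^esub> d) \<in> r)"

definition generated_congruence :: "('a, 'm) monoid_scheme \<Rightarrow> 'a rel \<Rightarrow> 'a rel" where
  "generated_congruence M R = \<Inter>{r. congruence M r \<and> R \<subseteq> r}"

text \<open>The element \<open>z\<close> represents the absorbing class of the quotient. It need not be absorbing
  in \<open>M\<close> itself.\<close>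

definition quotient_binoid :: "('a, 'm) monoid_scheme \<Rightarrow> 'a rel \<Rightarrow> 'a \<Rightarrow> 'a set binoid" where
  "quotient_binoid M r z =
    \<lparr>carrier = carrier M // r,
     mult = (\<lambda>X Y. \<Union>x\<in>X. \<Union>y\<in>Y. r `` {x \<otimes>\<^bsub>M\<^esub> y}),
     one = r `` {\<one>\<^bsub>M\<^esub>},
     absorbing = r `` {z}\<rparr>"

subsection \<open>Smash product\<close>

definition smash_rel ::
    "('a, 'm) binoid_scheme \<Rightarrow> ('b, 'n) binoid_scheme \<Rightarrow> ('a \<times> 'b) rel" where
  "smash_rel M N =
    {(p, q) \<in> (carrier M \<times> carrier N) \<times> (carrier M \<times> carrier N).
      p = q \<or>
      (fst p = absorbing M \<or> snd p = absorbing N) \<and> (fst q = absorbing M \<or> snd q = absorbing N)}"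

definition smash :: "('a, 'm) binoid_scheme \<Rightarrow> ('b, 'n) binoid_scheme \<Rightarrow> ('a \<times> 'b) set binoid"
    (infixr \<open>\<and>\<^sub>b\<close> 70) where
  "M \<and>\<^sub>b N = quotient_binoid (M \<times>\<times> N) (smash_rel M N) (absorbing M, absorbing N)"

subsection \<open>Localization at an element\<close>

definition powers :: "('a, 'm) monoid_scheme \<Rightarrow> 'a \<Rightarrow> 'a set" where
  "powers M f = range (\<lambda>n::nat. f [^]\<^bsub>M\<^esub> n)"

text \<open>A pair \<open>(a, s)\<close> stands for the fraction with numerator \<open>a\<close> and denominator \<open>s\<close>.\<close>

definition localization_rel :: "('a, 'm) monoid_scheme \<Rightarrow> 'a \<Rightarrow> ('a \<times> 'a) rel" where
  "localization_rel M f =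
    {((a, s), (b, t)) | a s b t.
      a \<in> carrier M \<and> b \<in> carrier M \<and> s \<in> powers M f \<and> t \<in> powers M f \<and>
      (\<exists>u \<in> powers M f. u \<otimes>\<^bsub>M\<^esub> (a \<otimes>\<^bsub>M\<^esub> t) = u \<otimes>\<^bsub>M\<^esub> (b \<otimes>\<^bsub>M\<^esub> s))}"

definition localization :: "('a, 'm) binoid_scheme \<Rightarrow> 'a \<Rightarrow> ('a \<times> 'a) set binoid" where
  "localization M f =
    quotient_binoid (M \<times>\<times> M\<lparr>carrier := powers M f\<rparr>) (localization_rel M f) (absorbing M, \<one>\<^bsub>M\<^esub>)"


section \<open>Simplicial complexes and their binoids\<close>

definition simplicial_complex :: "'a set \<Rightarrow> 'a set set \<Rightarrow> bool" where
  "simplicial_complex V \<Delta> \<longleftrightarrow> \<Delta> \<subseteq> Pow V \<and> (\<forall>F \<in> \<Delta>. \<forall>G \<subseteq> F. G \<in> \<Delta>) \<and> (\<forall>v \<in> V. {v} \<in> \<Delta>)"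

definition link :: "'a set set \<Rightarrow> 'a set \<Rightarrow> 'a set set" where
  "link \<Delta> F = {G \<in> \<Delta>. F \<union> G \<in> \<Delta> \<and> F \<inter> G = {}}"

definition link_vertices :: "'a set \<Rightarrow> 'a set set \<Rightarrow> 'a set \<Rightarrow> 'a set" where
  "link_vertices V \<Delta> F = {v \<in> V - F. F \<union> {v} \<in> \<Delta>}"

text \<open>The free commutative binoid on \<open>V\<close> is \<open>N\<^sup>\<infinity>\<close>, where \<open>N\<close> is the free commutative monoid on
  \<open>V\<close>, realized by the finite multisets over \<open>V\<close>.\<close>

definition free_comm_monoid :: "'a set \<Rightarrow> 'a multiset monoid" where
  "free_comm_monoid V = \<lparr>carrier = {m. set_mset m \<subseteq> V}, mult = (+), one = {#}\<rparr>"

definition free_binoid :: "'a set \<Rightarrow> 'a multiset option binoid" where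
  "free_binoid V = adjoin_absorbing (free_comm_monoid V)"

definition free_var :: "'a \<Rightarrow> 'a multiset option" where
  "free_var i = Some {#i#}"

definition simplicial_rel :: "'a set \<Rightarrow> 'a set set \<Rightarrow> 'a multiset option rel" where
  "simplicial_rel V \<Delta> = generated_congruence (free_binoid V)
    {(finprod (free_binoid V) free_var A, absorbing (free_binoid V)) | A. A \<subseteq> V \<and> A \<notin> \<Delta>}"

definition simplicial_binoid :: "'a set \<Rightarrow> 'a set set \<Rightarrow> 'a multiset option set binoid" where
  "simplicial_binoid V \<Delta> =
    quotient_binoid (free_binoid V) (simplicial_rel V \<Delta>) (absorbing (free_binoid V))"

definition simplicial_var :: "'a set \<Rightarrow> 'a set set \<Rightarrow> 'a \<Rightarrow> 'a multiset option set" where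
  "simplicial_var V \<Delta> i = simplicial_rel V \<Delta> `` {free_var i}"

text \<open>The element \<open>x\<^sub>F\<close>, that is, the sum of the \<open>x\<^sub>i\<close> over \<open>i \<in> F\<close> in additive notation.\<close>

definition face_element :: "'a set \<Rightarrow> 'a set set \<Rightarrow> 'a set \<Rightarrow> 'a multiset option set" where
  "face_element V \<Delta> F = finprod (simplicial_binoid V \<Delta>) (simplicial_var V \<Delta>) F"


section \<open>Well-definedness\<close>

lemma simplicial_complex_link:
  assumes "simplicial_complex V \<Delta>"
  shows "simplicial_complex (link_vertices V \<Delta> F) (link \<Delta> F)"
proof -
  have sub: "\<Delta> \<subseteq> Pow V" and down: "\<And>G H. G \<in> \<Delta> \<Longrightarrow> H \<subseteq> G \<Longrightarrow> H \<in> \<Delta>"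
    and sing: "\<And>v. v \<in> V \<Longrightarrow> {v} \<in> \<Delta>"
    using assms by (auto simp: simplicial_complex_def)
  have "v \<in> link_vertices V \<Delta> F" if "G \<in> link \<Delta> F" "v \<in> G" for G v
  proof -
    have "F \<union> {v} \<in> \<Delta>"
      using that down[of "F \<union> G" "F \<union> {v}"] by (simp add: link_def)
    then show ?thesis
      using that sub by (auto simp: link_def link_vertices_def)
  qed
  moreover have "H \<in> link \<Delta> F" if "G \<in> link \<Delta> F" "H \<subseteq> G" for G H
  proof -
    have "H \<in> \<Delta>" "F \<union> H \<in> \<Delta>"
      using that down[of G H] down[of "F \<union> G" "F \<union> H"] by (auto simp: link_def)
    then show ?thesis
      using that by (auto simp: link_def)
  qed
  moreover have "{v} \<in> link \<Delta> F" if "v \<in> link_vertices V \<Delta> F" for v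
    using that sing by (simp add: link_def link_vertices_def)
  ultimately show ?thesis
    unfolding simplicial_complex_def by blast
qed

lemma mult_quotient_binoid:
  assumes "congruence M r" "x \<in> carrier M" "y \<in> carrier M"
  shows "r `` {x} \<otimes>\<^bsub>quotient_binoid M r z\<^esub> r `` {y} = r `` {x \<otimes>\<^bsub>M\<^esub> y}"
proof -
  have eq: "equiv (carrier M) r"
    using assms by (simp add: congruence_def)
  have "(\<lambda>x y. r `` {x \<otimes>\<^bsub>M\<^esub> y}) respects2 r"
    using assms(1) eq unfolding congruence_def
    by (intro congruent2I') (metis equiv_class_eq)
  from UN_equiv_class2[OF eq eq this assms(2,3)] show ?thesis
    by (simp add: quotient_binoid_def)
qed

lemma binoid_quotient_binoid:
  assumes "comm_monoid M" "congruence M r" "z \<in> carrier M"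
    and "\<And>x. x \<in> carrier M \<Longrightarrow> (z \<otimes>\<^bsub>M\<^esub> x, z) \<in> r"
  shows "binoid (quotient_binoid M r z)"
proof -
  interpret comm_monoid M by fact
  let ?Q = "quotient_binoid M r z"
  have eq: "equiv (carrier M) r"
    using assms by (simp add: congruence_def)
  note m = mult_quotient_binoid[OF assms(2)]
  have car: "carrier ?Q = carrier M // r" and one: "\<one>\<^bsub>?Q\<^esub> = r `` {\<one>\<^bsub>M\<^esub>}"
    and ab: "absorbing ?Q = r `` {z}"
    by (simp_all add: quotient_binoid_def)
  show ?thesis
  proof (intro binoid.intro binoid_axioms.intro)
    show "absorbing ?Q \<otimes>\<^bsub>?Q\<^esub> X = absorbing ?Q" if "X \<in> carrier ?Q" for X
      using that assms(3,4) unfolding car ab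
      by (elim quotientE) (auto simp: m intro!: equiv_class_eq[OF eq])
  next
    show "comm_monoid ?Q"
    proof (rule comm_monoidI)
      show "X \<otimes>\<^bsub>?Q\<^esub> Y = Y \<otimes>\<^bsub>?Q\<^esub> X" if "X \<in> carrier ?Q" "Y \<in> carrier ?Q" for X Y
        using that unfolding car by (elim quotientE) (simp add: m m_comm)
    qed (auto simp: car one m m_assoc elim!: quotientE intro!: quotientI)
  qed (simp add: car ab assms(3) quotientI)
qed

lemma binoid_adjoin_absorbing:
  assumes "comm_monoid N"
  shows "binoid (adjoin_absorbing N)"
proof -
  interpret comm_monoid N by fact
  show ?thesis
    by (intro binoid.intro binoid_axioms.intro comm_monoidI)
      (auto simp: adjoin_absorbing_def m_ac split: option.splits)
qed

lemma binoid_free_binoid: "binoid (free_binoid V)"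
  unfolding free_binoid_def
  by (rule binoid_adjoin_absorbing, unfold_locales)
    (auto simp: free_comm_monoid_def ac_simps)

lemma congruence_generated_congruence:
  assumes "monoid M" "R \<subseteq> carrier M \<times> carrier M"
  shows "congruence M (generated_congruence M R)"
proof -
  interpret monoid M by fact
  let ?R = "generated_congruence M R"
  have mem: "p \<in> ?R \<longleftrightarrow> (\<forall>r. congruence M r \<longrightarrow> R \<subseteq> r \<longrightarrow> p \<in> r)" for p
    by (auto simp: generated_congruence_def)
  have "congruence M (carrier M \<times> carrier M)"
    by (auto simp: congruence_def equiv_def refl_on_def sym_def trans_def)
  then have "?R \<subseteq> carrier M \<times> carrier M"
    using assms(2) by (auto simp: generated_congruence_def)
  moreover have "refl_on (carrier M) ?R"
    by (auto simp: mem refl_on_def congruence_def equiv_def)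
  moreover have "sym ?R"
    by (rule symI) (simp add: mem congruence_def equiv_def symD)
  moreover have "trans ?R"
  proof (rule transI)
    fix x y z assume *: "(x, y) \<in> ?R" "(y, z) \<in> ?R"
    show "(x, z) \<in> ?R"
      unfolding mem
    proof (intro allI impI)
      fix r assume r: "congruence M r" "R \<subseteq> r"
      then have "(x, y) \<in> r" "(y, z) \<in> r" "trans r"
        using * by (auto simp: mem congruence_def equiv_def)
      then show "(x, z) \<in> r" by (meson transD)
    qed
  qed
  moreover have "(a \<otimes>\<^bsub>M\<^esub> c, b \<otimes>\<^bsub>M\<^esub> d) \<in> ?R" if "(a, b) \<in> ?R" "(c, d) \<in> ?R" for a b c d
    unfolding mem
  proof (intro allI impI)
    fix r assume r: "congruence M r" "R \<subseteq> r"
    then have "(a, b) \<in> r" "(c, d) \<in> r"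
      using that by (auto simp: mem)
    with r show "(a \<otimes>\<^bsub>M\<^esub> c, b \<otimes>\<^bsub>M\<^esub> d) \<in> r" by (simp add: congruence_def)
  qed
  ultimately show ?thesis
    by (simp add: congruence_def equiv_def)
qed

lemma congruence_simplicial_rel: "congruence (free_binoid V) (simplicial_rel V \<Delta>)"
proof -
  interpret binoid "free_binoid V" by (rule binoid_free_binoid)
  have "free_var i \<in> carrier (free_binoid V)" if "i \<in> V" for i
    using that by (simp add: free_var_def free_binoid_def adjoin_absorbing_def free_comm_monoid_def)
  then show ?thesis
    unfolding simplicial_rel_def
    by (intro congruence_generated_congruence monoid_axioms) (auto intro!: finprod_closed)
qed

lemma binoid_simplicial_binoid: "binoid (simplicial_binoid V \<Delta>)"
proof -
  interpret binoid "free_binoid V" by (rule binoid_free_binoid)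
  have "equiv (carrier (free_binoid V)) (simplicial_rel V \<Delta>)"
    using congruence_simplicial_rel by (auto simp: congruence_def)
  then show ?thesis
    unfolding simplicial_binoid_def
    by (intro binoid_quotient_binoid comm_monoid_axioms congruence_simplicial_rel)
      (auto simp: equiv_def refl_on_def)
qed

lemma comm_monoid_DirProd:
  assumes "comm_monoid M" "comm_monoid N"
  shows "comm_monoid (M \<times>\<times> N)"
proof -
  interpret M: comm_monoid M by fact
  interpret N: comm_monoid N by fact
  show ?thesis
    by (rule comm_monoidI) (auto simp: M.m_ac N.m_ac)
qed

lemma congruence_smash_rel:
  assumes "binoid M" "binoid N"
  shows "congruence (M \<times>\<times> N) (smash_rel M N)"
proof -
  interpret M: binoid M by fact
  interpret N: binoid N by fact
  have M': "x \<otimes>\<^bsub>M\<^esub> absorbing M = absorbing M" if "x \<in> carrier M" for x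
    using that M.m_comm[of x "absorbing M"] by simp
  have N': "x \<otimes>\<^bsub>N\<^esub> absorbing N = absorbing N" if "x \<in> carrier N" for x
    using that N.m_comm[of x "absorbing N"] by simp
  have "equiv (carrier (M \<times>\<times> N)) (smash_rel M N)"
    by (auto simp: equiv_def refl_on_def smash_rel_def intro!: symI transI)
  moreover have "(a \<otimes>\<^bsub>M \<times>\<times> N\<^esub> c, b \<otimes>\<^bsub>M \<times>\<times> N\<^esub> d) \<in> smash_rel M N"
    if "(a, b) \<in> smash_rel M N" "(c, d) \<in> smash_rel M N" for a b c d
    using that by (cases a; cases b; cases c; cases d) (auto simp: smash_rel_def M' N')
  ultimately show ?thesis
    by (simp add: congruence_def)
qed

lemma binoid_smash:
  assumes "binoid M" "binoid N"
  shows "binoid (M \<and>\<^sub>b N)"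
proof -
  interpret M: binoid M by fact
  interpret N: binoid N by fact
  show ?thesis
    unfolding smash_def
    by (intro binoid_quotient_binoid comm_monoid_DirProd congruence_smash_rel assms
        M.comm_monoid_axioms N.comm_monoid_axioms) (auto simp: smash_rel_def)
qed

context comm_monoid
begin

lemma powers_closed: "f \<in> carrier G \<Longrightarrow> s \<in> powers G f \<Longrightarrow> s \<in> carrier G"
  by (auto simp: powers_def)

lemma one_mem_powers: "\<one> \<in> powers G f"
  unfolding powers_def by (rule range_eqI[of _ _ 0]) simp

lemma mult_mem_powers:
  "f \<in> carrier G \<Longrightarrow> s \<in> powers G f \<Longrightarrow> t \<in> powers G f \<Longrightarrow> s \<otimes> t \<in> powers G f"
  by (auto simp: powers_def nat_pow_mult)

lemma comm_monoid_powers: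
  assumes "f \<in> carrier G"
  shows "comm_monoid (G\<lparr>carrier := powers G f\<rparr>)"
  by (rule comm_monoidI)
    (auto simp: assms one_mem_powers mult_mem_powers powers_closed[OF assms] m_ac)

lemma congruence_localization_rel:
  assumes f: "f \<in> carrier G"
  shows "congruence (G \<times>\<times> G\<lparr>carrier := powers G f\<rparr>) (localization_rel G f)"
proof -
  note c = powers_closed[OF f]
  let ?R = "localization_rel G f"
  have "trans ?R"
  proof (rule transI, clarsimp simp: localization_rel_def)
    fix a s b t d v u w
    assume *: "a \<in> carrier G" "b \<in> carrier G" "d \<in> carrier G"
      "s \<in> powers G f" "t \<in> powers G f" "v \<in> powers G f" "u \<in> powers G f" "w \<in> powers G f"
      and 1: "u \<otimes> (a \<otimes> t) = u \<otimes> (b \<otimes> s)" and 2: "w \<otimes> (b \<otimes> v) = w \<otimes> (d \<otimes> t)"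
    note ** = * c[OF *(4)] c[OF *(5)] c[OF *(6)] c[OF *(7)] c[OF *(8)]
    have "(u \<otimes> (w \<otimes> t)) \<otimes> (a \<otimes> v) = (w \<otimes> v) \<otimes> (u \<otimes> (a \<otimes> t))"
      using ** by (simp add: m_ac)
    also have "\<dots> = (u \<otimes> s) \<otimes> (w \<otimes> (b \<otimes> v))"
      unfolding 1 using ** by (simp add: m_ac)
    also have "\<dots> = (u \<otimes> (w \<otimes> t)) \<otimes> (d \<otimes> s)"
      unfolding 2 using ** by (simp add: m_ac)
    finally show "\<exists>x\<in>powers G f. x \<otimes> (a \<otimes> v) = x \<otimes> (d \<otimes> s)"
      using * f by (intro bexI[of _ "u \<otimes> (w \<otimes> t)"]) (auto intro!: mult_mem_powers)
  qed
  moreover have "sym ?R"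
    by (rule symI) (clarsimp simp: localization_rel_def, metis)
  moreover have "refl_on (carrier (G \<times>\<times> G\<lparr>carrier := powers G f\<rparr>)) ?R"
    using one_mem_powers by (auto simp: refl_on_def localization_rel_def)
  moreover have "?R \<subseteq> carrier (G \<times>\<times> G\<lparr>carrier := powers G f\<rparr>) \<times> carrier (G \<times>\<times> G\<lparr>carrier := powers G f\<rparr>)"
    by (auto simp: localization_rel_def)
  moreover have "((a \<otimes> a', s \<otimes> s'), (b \<otimes> b', t \<otimes> t')) \<in> ?R"
    if "((a, s), (b, t)) \<in> ?R" "((a', s'), (b', t')) \<in> ?R" for a s b t a' s' b' t'
  proof -
    from that obtain u u' where *: "a \<in> carrier G" "b \<in> carrier G" "a' \<in> carrier G" "b' \<in> carrier G"
      "s \<in> powers G f" "t \<in> powers G f" "s' \<in> powers G f" "t' \<in> powers G f"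
      "u \<in> powers G f" "u' \<in> powers G f"
      and 1: "u \<otimes> (a \<otimes> t) = u \<otimes> (b \<otimes> s)" and 2: "u' \<otimes> (a' \<otimes> t') = u' \<otimes> (b' \<otimes> s')"
      by (auto simp: localization_rel_def)
    note ** = * c[OF *(5)] c[OF *(6)] c[OF *(7)] c[OF *(8)] c[OF *(9)] c[OF *(10)]
    have "(u \<otimes> u') \<otimes> ((a \<otimes> a') \<otimes> (t \<otimes> t')) = (u \<otimes> (a \<otimes> t)) \<otimes> (u' \<otimes> (a' \<otimes> t'))"
      using ** by (simp add: m_ac)
    also have "\<dots> = (u \<otimes> u') \<otimes> ((b \<otimes> b') \<otimes> (s \<otimes> s'))"
      unfolding 1 2 using ** by (simp add: m_ac)
    finally show ?thesis
      using * f mult_mem_powers[OF f] by (auto simp: localization_rel_def)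
  qed
  ultimately show ?thesis
    by (auto simp: congruence_def equiv_def)
qed

end

lemma binoid_localization:
  assumes "binoid M" "f \<in> carrier M"
  shows "binoid (localization M f)"
proof -
  interpret binoid M by fact
  show ?thesis
    unfolding localization_def
  proof (rule binoid_quotient_binoid)
    show "((absorbing M, \<one>\<^bsub>M\<^esub>) \<otimes>\<^bsub>M \<times>\<times> M\<lparr>carrier := powers M f\<rparr>\<^esub> x, absorbing M, \<one>\<^bsub>M\<^esub>) \<in> localization_rel M f"
      if "x \<in> carrier (M \<times>\<times> M\<lparr>carrier := powers M f\<rparr>)" for x
      using that assms(2) one_mem_powers
      by (cases x) (auto simp: localization_rel_def powers_closed intro!: bexI[of _ "\<one>\<^bsub>M\<^esub>"])
  qed (use assms(2) one_mem_powers in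
      \<open>auto intro!: comm_monoid_DirProd comm_monoid_powers congruence_localization_rel comm_monoid_axioms\<close>)
qed

lemma face_element_closed:
  assumes "F \<subseteq> V"
  shows "face_element V \<Delta> F \<in> carrier (simplicial_binoid V \<Delta>)"
proof -
  interpret binoid "simplicial_binoid V \<Delta>" by (rule binoid_simplicial_binoid)
  have "simplicial_var V \<Delta> i \<in> carrier (simplicial_binoid V \<Delta>)" if "i \<in> V" for i
    using that
    by (auto simp: simplicial_var_def simplicial_binoid_def quotient_binoid_def free_var_def
        free_binoid_def adjoin_absorbing_def free_comm_monoid_def intro!: quotientI)
  then show ?thesis
    unfolding face_element_def using assms by (intro finprod_closed) auto
qed

end

theory Submission
  imports Defs
begin

text \<open>A monomial \<open>m\<close> over \<open>V\<close> splits into its part outside \<open>F\<close> and its exponent vector on \<open>F\<close>.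
  If all other variables are sent to the absorbing element, this induces a homomorphism
  \<open>M\<^sub>\<Delta> \<rightarrow> M\<^sub>\<Delta>\<^sub>' \<and> (\<int>\<^sup>F)\<^sup>\<infinity>\<close> that inverts \<open>x\<^sub>F\<close>. It sends \<open>m\<close> to the absorbing element iff
  \<open>F \<union> supp m\<close> is not a face, that is, iff \<open>x\<^sub>F + m\<close> is absorbing already in \<open>M\<^sub>\<Delta>\<close>, and it is
  injective on the other monomials. Every element of the smash product enters the image after
  adding a large multiple of \<open>x\<^sub>F\<close>. By the universal characterization of localizations,
  this is an isomorphism from the localization at \<open>x\<^sub>F\<close>.\<close>

section \<open>Maps out of quotients and localizations\<close>

lemma quotient_binoid_hom:
  assumes "congruence M r" "comm_monoid M" "\<phi> \<in> hom M N"
    and kernel: "\<And>x y. (x, y) \<in> r \<Longrightarrow> \<phi> x = \<phi> y"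
  obtains h where "h \<in> hom (quotient_binoid M r z) N"
    and "\<And>x. x \<in> carrier M \<Longrightarrow> h (r `` {x}) = \<phi> x"
proof
  interpret comm_monoid M by fact
  \<comment> \<open>By \<open>kernel\<close> the image of a class under \<open>\<phi>\<close> is a
    singleton, whose element is the value of the induced map.\<close>
  let ?h = "\<lambda>X. the_elem (\<phi> ` X)"
  have eq: "equiv (carrier M) r"
    using assms(1) by (simp add: congruence_def)
  show *: "?h (r `` {x}) = \<phi> x" if "x \<in> carrier M" for x
  proof -
    have "\<phi> y = \<phi> x" if "y \<in> r `` {x}" for y
      using that kernel[of x y] by simp
    then have "\<phi> ` (r `` {x}) = {\<phi> x}"
      using equiv_class_self[OF eq that] by blast
    then show ?thesis by simp
  qed
  show "?h \<in> hom (quotient_binoid M r z) N"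
  proof (rule homI)
    fix X assume "X \<in> carrier (quotient_binoid M r z)"
    then show "?h X \<in> carrier N"
      using assms(3) by (auto simp: quotient_binoid_def * hom_def Pi_iff elim!: quotientE)
  next
    fix X Y assume "X \<in> carrier (quotient_binoid M r z)" "Y \<in> carrier (quotient_binoid M r z)"
    then obtain x y where "x \<in> carrier M" "y \<in> carrier M" "X = r `` {x}" "Y = r `` {y}"
      by (auto simp: quotient_binoid_def elim!: quotientE)
    then show "?h (X \<otimes>\<^bsub>quotient_binoid M r z\<^esub> Y) = ?h X \<otimes>\<^bsub>N\<^esub> ?h Y"
      using assms(3) by (simp add: mult_quotient_binoid[OF assms(1)] * hom_mult)
  qed
qed

text \<open>The first isomorphism theorem for binoids: as an equivalence, \<open>kernel\<close>
  makes the induced map not only well defined but also injective.\<close>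

lemma quotient_binoid_isomorphic:
  assumes "congruence M r" "comm_monoid M" "\<phi> \<in> hom M N"
    and kernel: "\<And>x y. x \<in> carrier M \<Longrightarrow> y \<in> carrier M \<Longrightarrow> (x, y) \<in> r \<longleftrightarrow> \<phi> x = \<phi> y"
    and surj: "carrier N \<subseteq> \<phi> ` carrier M"
    and "\<phi> \<one>\<^bsub>M\<^esub> = \<one>\<^bsub>N\<^esub>" "\<phi> z = absorbing N" "z \<in> carrier M"
  shows "quotient_binoid M r z \<cong>\<^sub>b N"
proof -
  interpret comm_monoid M by fact
  have eq: "equiv (carrier M) r"
    using assms(1) by (simp add: congruence_def)
  have "\<phi> x = \<phi> y" if "(x, y) \<in> r" for x y
    using kernel[of x y] that eq by (auto simp: equiv_def)
  with assms(1-3) obtain h where h: "h \<in> hom (quotient_binoid M r z) N"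
    and *: "\<And>x. x \<in> carrier M \<Longrightarrow> h (r `` {x}) = \<phi> x"
    using quotient_binoid_hom by metis
  have car: "carrier (quotient_binoid M r z) = carrier M // r"
    by (simp add: quotient_binoid_def)
  have "inj_on h (carrier M // r)"
    by (rule inj_onI) (auto elim!: quotientE simp: * kernel[symmetric] intro!: equiv_class_eq[OF eq])
  moreover have "h ` (carrier M // r) = carrier N"
  proof
    show "h ` (carrier M // r) \<subseteq> carrier N"
      using h by (auto simp: hom_def car)
    show "carrier N \<subseteq> h ` (carrier M // r)"
    proof
      fix y assume "y \<in> carrier N"
      then obtain x where "x \<in> carrier M" "y = \<phi> x"
        using surj by auto
      then show "y \<in> h ` (carrier M // r)"
        using * by (intro image_eqI[of _ _ "r `` {x}"]) (auto intro: quotientI)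
    qed
  qed
  ultimately have "h \<in> binoid_iso (quotient_binoid M r z) N"
    using h assms(6-8) by (simp add: binoid_iso_def iso_def bij_betw_def quotient_binoid_def *)
  then show ?thesis
    by (auto simp: binoid_isomorphic_def)
qed

text \<open>Since \<open>g f\<close> is a unit, so is the image of every denominator, and sending
  the fraction \<open>(a, s)\<close> to \<open>g a\<close> times the inverse of \<open>g s\<close>
  makes sense. \<open>kernel\<close> provides the cancelling power in the definition of
  \<open>localization_rel\<close>; \<open>surj\<close> says that denominators in \<open>N\<close>
  can be cleared by images of powers of \<open>f\<close>.\<close>

lemma localization_isomorphic:
  assumes "binoid M" "binoid N" "f \<in> carrier M" "g \<in> hom M N"
    and one: "g \<one>\<^bsub>M\<^esub> = \<one>\<^bsub>N\<^esub>" and absorbing: "g (absorbing M) = absorbing N"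
    and unit: "g f \<in> Units N"
    and kernel: "\<And>a b. a \<in> carrier M \<Longrightarrow> b \<in> carrier M \<Longrightarrow> g a = g b \<Longrightarrow>
      \<exists>u \<in> powers M f. u \<otimes>\<^bsub>M\<^esub> a = u \<otimes>\<^bsub>M\<^esub> b"
    and surj: "\<And>y. y \<in> carrier N \<Longrightarrow> \<exists>a \<in> carrier M. \<exists>s \<in> powers M f. y \<otimes>\<^bsub>N\<^esub> g s = g a"
  shows "localization M f \<cong>\<^sub>b N"
proof -
  interpret M: binoid M by fact
  interpret N: binoid N by fact
  note c = M.powers_closed[OF \<open>f \<in> carrier M\<close>]
  have gc: "g a \<in> carrier N" if "a \<in> carrier M" for a
    using that \<open>g \<in> hom M N\<close> by (simp add: hom_in_carrier)
  have gm: "g (a \<otimes>\<^bsub>M\<^esub> b) = g a \<otimes>\<^bsub>N\<^esub> g b" if "a \<in> carrier M" "b \<in> carrier M" for a b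
    using that \<open>g \<in> hom M N\<close> by (simp add: hom_mult)
  have gu: "g s \<in> Units N" if "s \<in> powers M f" for s
  proof -
    have "g (f [^]\<^bsub>M\<^esub> n) \<in> Units N" for n :: nat
      by (induction n) (simp_all add: one gm \<open>f \<in> carrier M\<close> unit)
    with that show ?thesis by (auto simp: powers_def)
  qed
  have cancel: "x = y" if "u \<otimes>\<^bsub>N\<^esub> x = u \<otimes>\<^bsub>N\<^esub> y" "u \<in> Units N" "x \<in> carrier N" "y \<in> carrier N" for u x y
    using that N.Units_l_cancel by blast
  let ?A = "M \<times>\<times> M\<lparr>carrier := powers M f\<rparr>"
  let ?\<phi> = "\<lambda>(a, s). g a \<otimes>\<^bsub>N\<^esub> inv\<^bsub>N\<^esub> (g s)"
  \<comment> \<open>The value of a fraction is characterized as the unique solution of its defining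
    equation, so that almost no computation with inverses remains below.\<close>
  have frac: "?\<phi> (a, s) = y \<longleftrightarrow> g a = y \<otimes>\<^bsub>N\<^esub> g s"
    if "a \<in> carrier M" "s \<in> powers M f" "y \<in> carrier N" for a s y
  proof -
    have "?\<phi> (a, s) = y \<longleftrightarrow> g s \<otimes>\<^bsub>N\<^esub> (g a \<otimes>\<^bsub>N\<^esub> inv\<^bsub>N\<^esub> (g s)) = g s \<otimes>\<^bsub>N\<^esub> y"
      using that cancel[OF _ gu] by (auto simp: gc c gu)
    also have "g s \<otimes>\<^bsub>N\<^esub> (g a \<otimes>\<^bsub>N\<^esub> inv\<^bsub>N\<^esub> (g s)) = g a \<otimes>\<^bsub>N\<^esub> (g s \<otimes>\<^bsub>N\<^esub> inv\<^bsub>N\<^esub> (g s))"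
      using that by (simp add: gc c gu N.m_ac)
    also have "\<dots> = g a"
      using that by (simp add: gc gu)
    finally show ?thesis
      using that by (simp add: gc c N.m_comm)
  qed
  show ?thesis
    unfolding localization_def
  proof (rule quotient_binoid_isomorphic)
    show "congruence ?A (localization_rel M f)"
      using M.congruence_localization_rel \<open>f \<in> carrier M\<close> .
    show "comm_monoid ?A"
      using comm_monoid_DirProd M.comm_monoid_axioms M.comm_monoid_powers \<open>f \<in> carrier M\<close> by blast
    show "?\<phi> \<in> hom ?A N"
    proof (rule homI)
      fix x y assume "x \<in> carrier ?A" "y \<in> carrier ?A"
      then obtain a s b t where xy: "x = (a, s)" "y = (b, t)"
        and *: "a \<in> carrier M" "s \<in> powers M f" "b \<in> carrier M" "t \<in> powers M f"
        by auto
      have closed: "?\<phi> x \<in> carrier N" "?\<phi> y \<in> carrier N"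
        using * by (auto simp: xy gc gu)
      \<comment> \<open>The product of the two defining equations is the defining equation of the
        product fraction.\<close>
      have "g a = ?\<phi> x \<otimes>\<^bsub>N\<^esub> g s" "g b = ?\<phi> y \<otimes>\<^bsub>N\<^esub> g t"
        using * closed frac unfolding xy by blast+
      then have "g (a \<otimes>\<^bsub>M\<^esub> b) = (?\<phi> x \<otimes>\<^bsub>N\<^esub> g s) \<otimes>\<^bsub>N\<^esub> (?\<phi> y \<otimes>\<^bsub>N\<^esub> g t)"
        using * by (simp add: gm)
      also have "\<dots> = (?\<phi> x \<otimes>\<^bsub>N\<^esub> ?\<phi> y) \<otimes>\<^bsub>N\<^esub> g (s \<otimes>\<^bsub>M\<^esub> t)"
        using * closed by (simp add: gm gc c N.m_ac)
      finally have "?\<phi> (a \<otimes>\<^bsub>M\<^esub> b, s \<otimes>\<^bsub>M\<^esub> t) = ?\<phi> x \<otimes>\<^bsub>N\<^esub> ?\<phi> y"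
        using * closed \<open>f \<in> carrier M\<close> by (subst frac) (auto intro: M.mult_mem_powers)
      then show "?\<phi> (x \<otimes>\<^bsub>?A\<^esub> y) = ?\<phi> x \<otimes>\<^bsub>N\<^esub> ?\<phi> y"
        by (simp add: xy)
    qed (auto simp: gc gu)
    show "(x, y) \<in> localization_rel M f \<longleftrightarrow> ?\<phi> x = ?\<phi> y"
      if "x \<in> carrier ?A" "y \<in> carrier ?A" for x y
    proof (cases x; cases y)
      fix a s b t assume xy: "x = (a, s)" "y = (b, t)"
      with that have *: "a \<in> carrier M" "s \<in> powers M f" "b \<in> carrier M" "t \<in> powers M f"
        by auto
      \<comment> \<open>Cross-multiplication turns equality of the two values into equality of
        \<open>a\<close> times \<open>t\<close> and \<open>b\<close> times \<open>s\<close> under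
        \<open>g\<close>. By \<open>kernel\<close> this holds iff a power of \<open>f\<close>
        equates them in \<open>M\<close>.\<close>
      have "?\<phi> x = ?\<phi> y \<longleftrightarrow> g a = ?\<phi> (b, t) \<otimes>\<^bsub>N\<^esub> g s"
        unfolding xy using * by (intro frac) (auto simp: gc c gu)
      also have "\<dots> \<longleftrightarrow> g t \<otimes>\<^bsub>N\<^esub> g a = g t \<otimes>\<^bsub>N\<^esub> (?\<phi> (b, t) \<otimes>\<^bsub>N\<^esub> g s)"
        using * cancel[OF _ gu[of t]] by (auto simp: gc c gu)
      also have "g t \<otimes>\<^bsub>N\<^esub> (?\<phi> (b, t) \<otimes>\<^bsub>N\<^esub> g s) = (?\<phi> (b, t) \<otimes>\<^bsub>N\<^esub> g t) \<otimes>\<^bsub>N\<^esub> g s"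
        using * by (simp add: gc c gu N.m_ac)
      also have "?\<phi> (b, t) \<otimes>\<^bsub>N\<^esub> g t = g b"
        using * frac[of b t "?\<phi> (b, t)"] by (simp add: gc gu)
      also have "g t \<otimes>\<^bsub>N\<^esub> g a = g (a \<otimes>\<^bsub>M\<^esub> t)"
        using * by (simp add: gm gc c N.m_comm)
      also have "g b \<otimes>\<^bsub>N\<^esub> g s = g (b \<otimes>\<^bsub>M\<^esub> s)"
        using * by (simp add: gm c)
      also have "g (a \<otimes>\<^bsub>M\<^esub> t) = g (b \<otimes>\<^bsub>M\<^esub> s) \<longleftrightarrow>
        (\<exists>u \<in> powers M f. u \<otimes>\<^bsub>M\<^esub> (a \<otimes>\<^bsub>M\<^esub> t) = u \<otimes>\<^bsub>M\<^esub> (b \<otimes>\<^bsub>M\<^esub> s))"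
      proof
        assume "\<exists>u \<in> powers M f. u \<otimes>\<^bsub>M\<^esub> (a \<otimes>\<^bsub>M\<^esub> t) = u \<otimes>\<^bsub>M\<^esub> (b \<otimes>\<^bsub>M\<^esub> s)"
        then obtain u where u: "u \<in> powers M f" "u \<otimes>\<^bsub>M\<^esub> (a \<otimes>\<^bsub>M\<^esub> t) = u \<otimes>\<^bsub>M\<^esub> (b \<otimes>\<^bsub>M\<^esub> s)"
          by blast
        then have "g u \<otimes>\<^bsub>N\<^esub> g (a \<otimes>\<^bsub>M\<^esub> t) = g u \<otimes>\<^bsub>N\<^esub> g (b \<otimes>\<^bsub>M\<^esub> s)"
          using * by (metis c gm M.m_closed)
        then show "g (a \<otimes>\<^bsub>M\<^esub> t) = g (b \<otimes>\<^bsub>M\<^esub> s)"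
          by (rule cancel) (use * u(1) in \<open>auto simp: gc gu c\<close>)
      qed (rule kernel, use * in \<open>auto simp: c\<close>)
      finally show ?thesis
        using * by (simp add: xy localization_rel_def)
    qed
    show "carrier N \<subseteq> ?\<phi> ` carrier ?A"
    proof
      fix y assume "y \<in> carrier N"
      moreover from surj[OF this] obtain a s
        where *: "a \<in> carrier M" "s \<in> powers M f" "y \<otimes>\<^bsub>N\<^esub> g s = g a" by blast
      ultimately have "?\<phi> (a, s) = y"
        by (subst frac) auto
      with * show "y \<in> ?\<phi> ` carrier ?A"
        by (intro image_eqI[of _ _ "(a, s)"]) auto
    qed
    show "?\<phi> \<one>\<^bsub>?A\<^esub> = \<one>\<^bsub>N\<^esub>" "?\<phi> (absorbing M, \<one>\<^bsub>M\<^esub>) = absorbing N"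
      by (simp_all add: one absorbing)
    show "(absorbing M, \<one>\<^bsub>M\<^esub>) \<in> carrier ?A"
      by (simp add: M.one_mem_powers)
  qed
qed

section \<open>The word problem in simplicial binoids\<close>

text \<open>For finite \<open>V\<close> and a complex \<open>\<Delta>\<close> on \<open>V\<close>,
  these are the elements of the free binoid that become absorbing in the simplicial binoid, which is
  why \<open>None\<close> counts among them. Multiplicities are irrelevant.\<close>

definition nonface :: "'a set set \<Rightarrow> 'a multiset option \<Rightarrow> bool" where
  "nonface \<Delta> x \<longleftrightarrow> (case x of None \<Rightarrow> True | Some m \<Rightarrow> set_mset m \<notin> \<Delta>)"

lemma nonface_simps [simp]:
  "nonface \<Delta> None" "nonface \<Delta> (Some m) \<longleftrightarrow> set_mset m \<notin> \<Delta>"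
  by (simp_all add: nonface_def)

lemma free_binoid_simps [simp]:
  "None \<in> carrier (free_binoid V)"
  "Some m \<in> carrier (free_binoid V) \<longleftrightarrow> set_mset m \<subseteq> V"
  "Some m \<otimes>\<^bsub>free_binoid V\<^esub> Some m' = Some (m + m')"
  "None \<otimes>\<^bsub>free_binoid V\<^esub> x = None"
  "x \<otimes>\<^bsub>free_binoid V\<^esub> None = None"
  "\<one>\<^bsub>free_binoid V\<^esub> = Some {#}"
  "absorbing (free_binoid V) = None"
  by (auto simp: free_binoid_def adjoin_absorbing_def free_comm_monoid_def split: option.splits)

lemma finprod_free_var:
  assumes "finite A" "A \<subseteq> V"
  shows "finprod (free_binoid V) free_var A = Some (mset_set A)"
proof -
  interpret binoid "free_binoid V" by (rule binoid_free_binoid)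
  from assms show ?thesis
  proof (induction rule: finite_induct)
    case (insert v A)
    then have "finprod (free_binoid V) free_var (insert v A) =
      free_var v \<otimes>\<^bsub>free_binoid V\<^esub> finprod (free_binoid V) free_var A"
      by (intro finprod_insert) (auto simp: free_var_def)
    also have "\<dots> = Some {#v#} \<otimes>\<^bsub>free_binoid V\<^esub> Some (mset_set A)"
      using insert by (simp add: free_var_def[of v])
    finally show ?case
      using insert by simp
  qed simp
qed

text \<open>The nonfaces form an ideal of the free binoid, because \<open>\<Delta>\<close> is closed
  under subsets. The relation is the Rees congruence of this ideal: it collapses the ideal to one
  class and identifies nothing else.\<close>

lemma simplicial_rel_iff:
  assumes "finite V" and complex: "simplicial_complex V \<Delta>"
  shows "(x, y) \<in> simplicial_rel V \<Delta> \<longleftrightarrow>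
    x \<in> carrier (free_binoid V) \<and> y \<in> carrier (free_binoid V) \<and>
    (x = y \<or> nonface \<Delta> x \<and> nonface \<Delta> y)"
proof -
  let ?B = "free_binoid V"
  let ?r = "{(x, y). x \<in> carrier ?B \<and> y \<in> carrier ?B \<and> (x = y \<or> nonface \<Delta> x \<and> nonface \<Delta> y)}"
  let ?R = "{(finprod ?B free_var A, absorbing ?B) | A. A \<subseteq> V \<and> A \<notin> \<Delta>}"
  interpret binoid ?B by (rule binoid_free_binoid)
  have down: "H \<in> \<Delta>" if "G \<in> \<Delta>" "H \<subseteq> G" for G H
    using complex that unfolding simplicial_complex_def by blast
  \<comment> \<open>The ideal property: the support of a product contains the supports of both
    factors.\<close>
  have mult: "nonface \<Delta> (x \<otimes>\<^bsub>?B\<^esub> y)" if "nonface \<Delta> x \<or> nonface \<Delta> y" for x y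
    using that down by (cases x; cases y) auto
  have "congruence ?B ?r"
    unfolding congruence_def
  proof (intro conjI allI impI)
    show "equiv (carrier ?B) ?r"
      by (auto simp: equiv_def refl_on_def intro!: symI transI)
    show "(a \<otimes>\<^bsub>?B\<^esub> c, b \<otimes>\<^bsub>?B\<^esub> d) \<in> ?r" if "(a, b) \<in> ?r" "(c, d) \<in> ?r" for a b c d
      using that mult by auto
  qed
  \<comment> \<open>Finiteness matters here: over an infinite index set \<open>finprod\<close>
    defaults to the neutral element instead of a squarefree monomial.\<close>
  moreover have "?R \<subseteq> ?r"
    using \<open>finite V\<close> by (auto simp: finprod_free_var finite_subset)
  ultimately have sub: "simplicial_rel V \<Delta> \<subseteq> ?r"
    unfolding simplicial_rel_def generated_congruence_def by blast
  have cong: "congruence ?B (simplicial_rel V \<Delta>)"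
    by (rule congruence_simplicial_rel)
  then have eq: "equiv (carrier ?B) (simplicial_rel V \<Delta>)"
    by (simp add: congruence_def)
  then have rel_refl: "(x, x) \<in> simplicial_rel V \<Delta>" if "x \<in> carrier ?B" for x
    using that by (auto simp: equiv_def refl_on_def)
  have gen: "?R \<subseteq> simplicial_rel V \<Delta>"
    unfolding simplicial_rel_def generated_congruence_def by blast
  have dead: "(x, None) \<in> simplicial_rel V \<Delta>" if x: "nonface \<Delta> x" "x \<in> carrier ?B" for x
  proof (cases x)
    case None
    then show ?thesis by (simp add: rel_refl)
  next
    case (Some m)
    \<comment> \<open>The squarefree monomial on the support of \<open>m\<close> is equated with
      \<open>None\<close> by a generating relation. It divides \<open>m\<close>, so multiplying that
      relation by the cofactor \<open>m - ?s\<close> gives the claim for \<open>m\<close>.\<close>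
    let ?s = "mset_set (set_mset m)"
    from Some x have m: "set_mset m \<subseteq> V" "set_mset m \<notin> \<Delta>" by auto
    then have "(finprod ?B free_var (set_mset m), absorbing ?B) \<in> ?R"
      by blast
    then have "(Some ?s, None) \<in> simplicial_rel V \<Delta>"
      using gen m finprod_free_var[of "set_mset m" V] by (metis (no_types, lifting)
        finite_set_mset free_binoid_simps(7) subsetD)
    moreover have "(Some (m - ?s), Some (m - ?s)) \<in> simplicial_rel V \<Delta>"
      using m by (intro rel_refl) (auto dest: in_diffD)
    ultimately have "(Some ?s \<otimes>\<^bsub>?B\<^esub> Some (m - ?s), None \<otimes>\<^bsub>?B\<^esub> Some (m - ?s)) \<in> simplicial_rel V \<Delta>"
      using cong unfolding congruence_def by blast
    then show ?thesis
      by (simp add: Some mset_set_set_mset_msubset)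
  qed
  have "?r \<subseteq> simplicial_rel V \<Delta>"
  proof
    fix p assume "p \<in> ?r"
    then obtain x y where "p = (x, y)" "x \<in> carrier ?B" "y \<in> carrier ?B"
      "x = y \<or> nonface \<Delta> x \<and> nonface \<Delta> y" by auto
    \<comment> \<open>Two nonfaces are related through \<open>None\<close>.\<close>
    then show "p \<in> simplicial_rel V \<Delta>"
      using rel_refl dead eq by (metis equiv_def symD transD)
  qed
  with sub have "simplicial_rel V \<Delta> = ?r" by blast
  then show ?thesis by simp
qed

lemma face_element_eq:
  assumes "finite F" "F \<subseteq> V"
  shows "face_element V \<Delta> F = simplicial_rel V \<Delta> `` {Some (mset_set F)}"
proof -
  let ?M = "simplicial_binoid V \<Delta>"
  interpret M: binoid ?M by (rule binoid_simplicial_binoid)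
  have var: "simplicial_var V \<Delta> v \<in> carrier ?M" if "v \<in> V" for v
    using that by (auto simp: simplicial_var_def simplicial_binoid_def quotient_binoid_def
        free_var_def intro!: quotientI)
  from assms show ?thesis
    unfolding face_element_def
  proof (induction rule: finite_induct)
    case empty
    show ?case
      unfolding M.finprod_empty by (simp add: simplicial_binoid_def quotient_binoid_def)
  next
    case (insert v A)
    then have "finprod ?M (simplicial_var V \<Delta>) (insert v A) =
      simplicial_var V \<Delta> v \<otimes>\<^bsub>?M\<^esub> finprod ?M (simplicial_var V \<Delta>) A"
      using var by (intro M.finprod_insert) auto
    also have "\<dots> = simplicial_rel V \<Delta> `` {Some {#v#}} \<otimes>\<^bsub>?M\<^esub> simplicial_rel V \<Delta> `` {Some (mset_set A)}"
      using insert by (simp add: simplicial_var_def[of V \<Delta> v] free_var_def)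
    also have "\<dots> = simplicial_rel V \<Delta> `` {Some {#v#} \<otimes>\<^bsub>free_binoid V\<^esub> Some (mset_set A)}"
      unfolding simplicial_binoid_def using insert
      by (intro mult_quotient_binoid congruence_simplicial_rel) auto
    finally show ?case
      using insert by simp
  qed
qed

section \<open>Localization at a face\<close>

text \<open>On variables: those in \<open>F\<close> go to the neutral element, link vertices to
  themselves, all others to the absorbing element. The last is forced for the remaining vertices of
  \<open>V\<close>: their product with the face element is absorbing, and the face element has to
  become invertible.\<close>

definition off_face :: "'a set \<Rightarrow> 'a set set \<Rightarrow> 'a set \<Rightarrow> 'a multiset option \<Rightarrow> 'a multiset option" where
  "off_face V \<Delta> F x = (case x of None \<Rightarrow> None | Some m \<Rightarrow>
    if set_mset m \<subseteq> F \<union> link_vertices V \<Delta> F then Some (filter_mset (\<lambda>v. v \<notin> F) m) else None)"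

text \<open>The component in the factor belonging to the free abelian group on \<open>F\<close>.
  Restriction to \<open>F\<close> makes the exponent vectors extensional, as the carrier of
  \<open>product_group\<close> requires.\<close>

definition face_exponents :: "'a set \<Rightarrow> 'a multiset option \<Rightarrow> ('a \<Rightarrow> int) option" where
  "face_exponents F = map_option (\<lambda>m. \<lambda>v\<in>F. int (count m v))"

lemma off_face_hom: "off_face V \<Delta> F \<in> hom (free_binoid V) (free_binoid (link_vertices V \<Delta> F))"
proof (rule homI)
  fix x y
  show "off_face V \<Delta> F (x \<otimes>\<^bsub>free_binoid V\<^esub> y) =
    off_face V \<Delta> F x \<otimes>\<^bsub>free_binoid (link_vertices V \<Delta> F)\<^esub> off_face V \<Delta> F y"
    by (cases x; cases y) (auto simp: off_face_def)
qed (auto simp: off_face_def split: option.splits)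

lemma adjoin_absorbing_simps [simp]:
  "None \<in> carrier (adjoin_absorbing N)"
  "Some a \<in> carrier (adjoin_absorbing N) \<longleftrightarrow> a \<in> carrier N"
  "Some a \<otimes>\<^bsub>adjoin_absorbing N\<^esub> Some b = Some (a \<otimes>\<^bsub>N\<^esub> b)"
  "None \<otimes>\<^bsub>adjoin_absorbing N\<^esub> x = None"
  "x \<otimes>\<^bsub>adjoin_absorbing N\<^esub> None = None"
  "\<one>\<^bsub>adjoin_absorbing N\<^esub> = Some \<one>\<^bsub>N\<^esub>"
  "absorbing (adjoin_absorbing N) = None"
  by (auto simp: adjoin_absorbing_def split: option.splits)

lemma face_exponents_hom:
  "face_exponents F \<in> hom (free_binoid V) (adjoin_absorbing (product_group F (\<lambda>_. integer_group)))"
proof (rule homI)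
  fix x y
  show "face_exponents F (x \<otimes>\<^bsub>free_binoid V\<^esub> y) =
    face_exponents F x \<otimes>\<^bsub>adjoin_absorbing (product_group F (\<lambda>_. integer_group))\<^esub> face_exponents F y"
    by (cases x; cases y) (auto simp: face_exponents_def intro!: restrict_ext)
next
  fix x
  show "face_exponents F x \<in> carrier (adjoin_absorbing (product_group F (\<lambda>_. integer_group)))"
    by (cases x) (auto simp: face_exponents_def)
qed

text \<open>The support of the filtered monomial is disjoint from \<open>F\<close> and has the same
  union with \<open>F\<close> as the support of \<open>m\<close>, so it lies in the link iff this
  union is a face. If \<open>m\<close> involves a vertex outside \<open>F\<close> and the link, this
  union cannot be a face, in accordance with the value \<open>None\<close>.\<close>

lemma nonface_off_face:
  assumes "simplicial_complex V \<Delta>"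
  shows "nonface (link \<Delta> F) (off_face V \<Delta> F x) \<longleftrightarrow>
    (case x of None \<Rightarrow> True | Some m \<Rightarrow> F \<union> set_mset m \<notin> \<Delta>)"
proof (cases x)
  case (Some m)
  have sub: "\<Delta> \<subseteq> Pow V" and down: "\<And>G H. G \<in> \<Delta> \<Longrightarrow> H \<subseteq> G \<Longrightarrow> H \<in> \<Delta>"
    using assms by (auto simp: simplicial_complex_def)
  have *: "F \<union> {v \<in> set_mset m. v \<notin> F} = F \<union> set_mset m" by auto
  have "set_mset m \<subseteq> F \<union> link_vertices V \<Delta> F" if "F \<union> set_mset m \<in> \<Delta>"
    using that sub down[of "F \<union> set_mset m" "insert _ F"] by (auto simp: link_vertices_def)
  moreover have "{v \<in> set_mset m. v \<notin> F} \<in> link \<Delta> F \<longleftrightarrow> F \<union> set_mset m \<in> \<Delta>"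
    using down[of "F \<union> set_mset m" "{v \<in> set_mset m. v \<notin> F}"] by (auto simp: link_def *)
  ultimately show ?thesis
    by (auto simp: Some off_face_def)
qed (simp add: off_face_def)

theorem localization_at_face:
  assumes "finite V" and complex: "simplicial_complex V \<Delta>" and "F \<in> \<Delta>"
  shows "localization (simplicial_binoid V \<Delta>) (face_element V \<Delta> F)
    \<cong>\<^sub>b simplicial_binoid (link_vertices V \<Delta> F) (link \<Delta> F)
        \<and>\<^sub>b adjoin_absorbing (product_group F (\<lambda>_. integer_group))"
proof -
  let ?W = "link_vertices V \<Delta> F"
  let ?M = "simplicial_binoid V \<Delta>"
  let ?G = "product_group F (\<lambda>_. integer_group)"
  let ?Z = "adjoin_absorbing ?G"
  let ?L = "simplicial_binoid ?W (link \<Delta> F)"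
  let ?B = "free_binoid V"
  define r where "r = simplicial_rel V \<Delta>"
  define l where "l = simplicial_rel ?W (link \<Delta> F)"
  define q where "q = smash_rel ?L ?Z"
  have "F \<subseteq> V" using complex \<open>F \<in> \<Delta>\<close> by (auto simp: simplicial_complex_def)
  then have "finite F" using \<open>finite V\<close> finite_subset by blast
  have "finite ?W" using \<open>finite V\<close> by (simp add: link_vertices_def)
  have down: "H \<in> \<Delta>" if "G \<in> \<Delta>" "H \<subseteq> G" for G H
    using complex that unfolding simplicial_complex_def by blast
  note r_iff = simplicial_rel_iff[OF \<open>finite V\<close> complex, folded r_def]
  note l_iff = simplicial_rel_iff[OF \<open>finite ?W\<close> simplicial_complex_link[OF complex], folded l_def]
  interpret B: binoid ?B by (rule binoid_free_binoid)
  interpret M: binoid ?M by (rule binoid_simplicial_binoid)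
  interpret L: binoid ?L by (rule binoid_simplicial_binoid)
  have "comm_monoid ?G"
    by (rule comm_monoidI) (auto simp: PiE_iff extensional_def fun_eq_iff)
  then interpret Z: binoid ?Z
    by (rule binoid_adjoin_absorbing)
  let ?N = "?L \<and>\<^sub>b ?Z"
  interpret N: binoid ?N by (rule binoid_smash) unfold_locales
  have r_cong: "congruence ?B r" and l_cong: "congruence (free_binoid ?W) l"
    by (simp_all add: r_def l_def congruence_simplicial_rel)
  have q_cong: "congruence (?L \<times>\<times> ?Z) q"
    unfolding q_def by (intro congruence_smash_rel) unfold_locales
  have r_eq: "equiv (carrier ?B) r" and l_eq: "equiv (carrier (free_binoid ?W)) l"
    and q_eq: "equiv (carrier (?L \<times>\<times> ?Z)) q"
    using r_cong l_cong q_cong by (auto simp: congruence_def)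
  have M_eq: "?M = quotient_binoid ?B r None"
    by (simp add: simplicial_binoid_def r_def)
  have M_carrier: "carrier ?M = carrier ?B // r" and M_absorbing: "absorbing ?M = r `` {None}"
    and M_one: "\<one>\<^bsub>?M\<^esub> = r `` {Some {#}}"
    by (simp_all add: simplicial_binoid_def quotient_binoid_def r_def)
  have L_carrier: "carrier ?L = carrier (free_binoid ?W) // l" and L_absorbing: "absorbing ?L = l `` {None}"
    and L_one: "\<one>\<^bsub>?L\<^esub> = l `` {Some {#}}"
    by (simp_all add: simplicial_binoid_def quotient_binoid_def l_def)
  have L_mult: "l `` {x} \<otimes>\<^bsub>?L\<^esub> l `` {y} = l `` {x \<otimes>\<^bsub>free_binoid ?W\<^esub> y}"
    if "x \<in> carrier (free_binoid ?W)" "y \<in> carrier (free_binoid ?W)" for x y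
    using mult_quotient_binoid[OF l_cong that] by (simp add: simplicial_binoid_def l_def)
  have M_mult: "r `` {x} \<otimes>\<^bsub>?M\<^esub> r `` {y} = r `` {x \<otimes>\<^bsub>?B\<^esub> y}"
    if "x \<in> carrier ?B" "y \<in> carrier ?B" for x y
    using mult_quotient_binoid[OF r_cong that] by (simp add: M_eq)
  have N_carrier: "carrier ?N = (carrier (?L \<times>\<times> ?Z)) // q"
    and N_one: "\<one>\<^bsub>?N\<^esub> = q `` {(\<one>\<^bsub>?L\<^esub>, \<one>\<^bsub>?Z\<^esub>)}"
    and N_absorbing: "absorbing ?N = q `` {(absorbing ?L, None)}"
    by (simp_all add: smash_def quotient_binoid_def q_def)

  \<comment> \<open>Computing in the smash product with representatives from the free binoid\<close>
  define \<tau> where "\<tau> x z = q `` {(l `` {x}, z)}" for x z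
  have \<tau>_closed: "\<tau> x z \<in> carrier ?N" if "x \<in> carrier (free_binoid ?W)" "z \<in> carrier ?Z" for x z
    using that unfolding \<tau>_def N_carrier by (intro quotientI) (auto simp: L_carrier intro: quotientI)
  have \<tau>_mult: "\<tau> x z \<otimes>\<^bsub>?N\<^esub> \<tau> y w = \<tau> (x \<otimes>\<^bsub>free_binoid ?W\<^esub> y) (z \<otimes>\<^bsub>?Z\<^esub> w)"
    if "x \<in> carrier (free_binoid ?W)" "z \<in> carrier ?Z"
      "y \<in> carrier (free_binoid ?W)" "w \<in> carrier ?Z" for x z y w
    using that mult_quotient_binoid[OF q_cong, of "(l `` {x}, z)" "(l `` {y}, w)"]
    by (simp add: \<tau>_def smash_def q_def[symmetric] L_carrier L_mult quotientI)
  have \<tau>_one: "\<one>\<^bsub>?N\<^esub> = \<tau> (Some {#}) (Some \<one>\<^bsub>?G\<^esub>)"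
    by (simp add: \<tau>_def N_one L_one del: one_product_group)
  have \<tau>_absorbing: "absorbing ?N = \<tau> None None"
    by (simp add: \<tau>_def N_absorbing L_absorbing)
  \<comment> \<open>The word problem in the link binoid is combined with the collapse in the smash
    product. Two different nonfaces \<open>x\<close> and \<open>y\<close> already belong to the
    absorbing case, so outside of it both components have to agree literally.\<close>
  have \<tau>_eq_iff: "\<tau> x z = \<tau> y w \<longleftrightarrow>
      (nonface (link \<Delta> F) x \<or> z = None) \<and> (nonface (link \<Delta> F) y \<or> w = None) \<or> x = y \<and> z = w"
    if *: "x \<in> carrier (free_binoid ?W)" "z \<in> carrier ?Z"
      "y \<in> carrier (free_binoid ?W)" "w \<in> carrier ?Z" for x z y w
  proof -
    have "\<tau> x z = \<tau> y w \<longleftrightarrow> ((l `` {x}, z), (l `` {y}, w)) \<in> q"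
      unfolding \<tau>_def using * by (intro eq_equiv_class_iff[OF q_eq]) (auto simp: L_carrier quotientI)
    also have "\<dots> \<longleftrightarrow> l `` {x} = l `` {y} \<and> z = w \<or>
        (l `` {x} = l `` {None} \<or> z = None) \<and> (l `` {y} = l `` {None} \<or> w = None)"
      using * by (auto simp: q_def smash_rel_def L_carrier L_absorbing quotientI)
    also have "l `` {x} = l `` {y} \<longleftrightarrow> x = y \<or> nonface (link \<Delta> F) x \<and> nonface (link \<Delta> F) y"
      using * by (subst eq_equiv_class_iff[OF l_eq]) (auto simp: l_iff)
    also have "l `` {x} = l `` {None} \<longleftrightarrow> nonface (link \<Delta> F) x"
      using * by (subst eq_equiv_class_iff[OF l_eq]) (auto simp: l_iff)
    also have "l `` {y} = l `` {None} \<longleftrightarrow> nonface (link \<Delta> F) y"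
      using * by (subst eq_equiv_class_iff[OF l_eq]) (auto simp: l_iff)
    finally show ?thesis by blast
  qed
  have \<tau>_cases: "\<exists>x \<in> carrier (free_binoid ?W). \<exists>z \<in> carrier ?Z. y = \<tau> x z" if "y \<in> carrier ?N" for y
    using that unfolding N_carrier \<tau>_def by (auto simp: L_carrier elim!: quotientE)

  \<comment> \<open>The homomorphism to the smash product and its kernel\<close>
  let ?p = "off_face V \<Delta> F" and ?e = "face_exponents F"
  have p_closed: "?p x \<in> carrier (free_binoid ?W)" and e_closed: "?e x \<in> carrier ?Z"
    if "x \<in> carrier ?B" for x
    using that off_face_hom face_exponents_hom by (metis hom_in_carrier)+
  define \<phi> where "\<phi> x = \<tau> (?p x) (?e x)" for x
  have e_None: "?e x = None \<longleftrightarrow> x = None" for x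
    by (simp add: face_exponents_def)
  \<comment> \<open>These are the monomials whose product with the face element has nonface support;
    together with \<open>None\<close> they form the kernel class of the absorbing element under
    \<open>\<phi>\<close>.\<close>
  define vanishes where "vanishes x \<longleftrightarrow> (case x of None \<Rightarrow> True | Some m \<Rightarrow> F \<union> set_mset m \<notin> \<Delta>)" for x
  \<comment> \<open>A monomial is recovered from its part outside \<open>F\<close> and its exponents
    on \<open>F\<close>. Not vanishing guarantees that \<open>?p x\<close> is not
    \<open>None\<close>, so that the first part is really known.\<close>
  have split_inj: "x = y" if "?p x = ?p y" "?e x = ?e y" "\<not> vanishes x" for x y
  proof (cases x; cases y)
    fix m m' assume xy: "x = Some m" "y = Some m'"
    have "?p x \<noteq> None"
      using nonface_off_face[OF complex, of F x] \<open>\<not> vanishes x\<close>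
      unfolding vanishes_def by (metis nonface_simps(1))
    with that xy have "filter_mset (\<lambda>v. v \<notin> F) m = filter_mset (\<lambda>v. v \<notin> F) m'"
      by (auto simp: off_face_def split: if_splits)
    then have out: "count m v = count m' v" if "v \<notin> F" for v
      using that by (metis (no_types, lifting) count_filter_mset)
    have "(\<lambda>v\<in>F. int (count m v)) = (\<lambda>v\<in>F. int (count m' v))"
      using that xy by (simp add: face_exponents_def)
    then have "count m v = count m' v" if "v \<in> F" for v
      using that by (metis of_nat_eq_iff restrict_apply')
    with out have "m = m'" by (intro multiset_eqI) blast
    with xy show ?thesis by simp
  qed (use that in \<open>auto simp: face_exponents_def\<close>)
  have \<phi>_eq_iff: "\<phi> x = \<phi> y \<longleftrightarrow> x = y \<or> vanishes x \<and> vanishes y"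
    if "x \<in> carrier ?B" "y \<in> carrier ?B" for x y
  proof -
    have *: "nonface (link \<Delta> F) (?p x) \<or> ?e x = None \<longleftrightarrow> vanishes x" for x
      by (auto simp: nonface_off_face[OF complex] e_None vanishes_def)
    show ?thesis
      using \<tau>_eq_iff[OF p_closed e_closed p_closed e_closed, of x x y y] that split_inj[of x y] split_inj[of y x]
      unfolding \<phi>_def * by metis
  qed
  have \<phi>_hom: "\<phi> \<in> hom ?B ?N"
    using off_face_hom[of V \<Delta> F] face_exponents_hom[of F V]
    by (intro homI) (auto simp: \<phi>_def \<tau>_closed \<tau>_mult p_closed e_closed hom_mult)
  have "\<phi> x = \<phi> y" if "(x, y) \<in> r" for x y
  proof -
    \<comment> \<open>A nonface stays a nonface after joining \<open>F\<close>; this is why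
      \<open>\<phi>\<close> descends to the simplicial binoid.\<close>
    have "vanishes x" if "nonface \<Delta> x" for x
      using that down[of "F \<union> set_mset _"] by (cases x) (auto simp: vanishes_def)
    with that show ?thesis
      by (auto simp: r_iff \<phi>_eq_iff)
  qed
  then obtain g where g_hom: "g \<in> hom ?M ?N" and g: "\<And>x. x \<in> carrier ?B \<Longrightarrow> g (r `` {x}) = \<phi> x"
    using quotient_binoid_hom[OF r_cong B.comm_monoid_axioms \<phi>_hom, where z = None]
    unfolding M_eq by blast

  \<comment> \<open>Powers of the face element and their images\<close>
  let ?f = "face_element V \<Delta> F"
  have f: "?f = r `` {Some (mset_set F)}"
    using face_element_eq[OF \<open>finite F\<close> \<open>F \<subseteq> V\<close>] by (simp add: r_def)
  have supp_pow: "set_mset (repeat_mset k (mset_set F)) \<subseteq> F" for k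
    using \<open>finite F\<close> by (auto simp flip: count_greater_zero_iff split: if_splits simp: count_mset_set')
  have f_pow: "?f [^]\<^bsub>?M\<^esub> k = r `` {Some (repeat_mset k (mset_set F))}" for k :: nat
  proof (induction k)
    case 0
    show ?case by (simp add: M_one)
  next
    case (Suc k)
    then show ?case
      using \<open>F \<subseteq> V\<close> \<open>finite F\<close> supp_pow[of k] unfolding M.nat_pow_Suc
      by (simp add: f M_mult add.commute subset_trans)
  qed
  \<comment> \<open>The constant exponent vectors: nonnegative \<open>k\<close> gives the image of
    the \<open>k\<close>-th power of the face element, and \<open>k = - 1\<close> will give the
    inverse of its image.\<close>
  define c where "c k = (\<lambda>v\<in>F. k)" for k :: int
  have \<phi>_pow: "\<phi> (Some (repeat_mset k (mset_set F))) = \<tau> (Some {#}) (Some (c (int k)))" for k :: nat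
  proof -
    let ?m = "repeat_mset k (mset_set F)"
    have "filter_mset (\<lambda>v. v \<notin> F) ?m = {#}"
      using supp_pow by (intro multiset_eqI) (auto simp: count_mset_set')
    moreover have "(\<lambda>v\<in>F. int (count ?m v)) = c (int k)"
      using \<open>finite F\<close> by (auto simp: c_def intro!: restrict_ext)
    moreover have "set_mset ?m \<subseteq> F \<union> ?W"
      using supp_pow by blast
    ultimately show ?thesis
      by (simp only: \<phi>_def off_face_def face_exponents_def option.case option.map if_True)
  qed
  have c_closed: "c k \<in> carrier ?G" for k
    by (simp add: c_def)

  \<comment> \<open>Verification of the localization criterion\<close>
  show ?thesis
  proof (rule localization_isomorphic)
    show "?f \<in> carrier ?M"
      using \<open>F \<subseteq> V\<close> by (rule face_element_closed)
    show "g \<in> hom ?M ?N" by fact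
    show "g \<one>\<^bsub>?M\<^esub> = \<one>\<^bsub>?N\<^esub>"
      using \<phi>_pow[of 0] g[of "Some {#}"]
      by (simp add: \<tau>_one M_one c_def)
    show "g (absorbing ?M) = absorbing ?N"
      using g[of None]
      by (simp add: \<tau>_absorbing M_absorbing \<phi>_def off_face_def face_exponents_def)
    show "g ?f \<in> Units ?N"
    proof -
      have "g ?f = \<tau> (Some {#}) (Some (c 1))"
        using g[of "Some (mset_set F)"] \<phi>_pow[of 1] \<open>F \<subseteq> V\<close> \<open>finite F\<close> by (simp add: f)
      moreover have "\<tau> (Some {#}) (Some (c (- 1))) \<otimes>\<^bsub>?N\<^esub> \<tau> (Some {#}) (Some (c 1)) = \<one>\<^bsub>?N\<^esub>"
        using c_closed by (subst \<tau>_mult) (auto simp: \<tau>_one c_def intro!: arg_cong2[of _ _ _ _ \<tau>] restrict_ext)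
      ultimately show ?thesis
        using c_closed by (auto simp: Units_def N.m_comm \<tau>_closed intro!: bexI[of _ "\<tau> (Some {#}) (Some (c (- 1)))"])
    qed
    show "\<exists>u \<in> powers ?M ?f. u \<otimes>\<^bsub>?M\<^esub> a = u \<otimes>\<^bsub>?M\<^esub> b"
      if "a \<in> carrier ?M" "b \<in> carrier ?M" "g a = g b" for a b
    proof -
      from that obtain x y where xy: "x \<in> carrier ?B" "y \<in> carrier ?B" "a = r `` {x}" "b = r `` {y}"
        by (auto simp: M_carrier elim!: quotientE)
      with that have "x = y \<or> vanishes x \<and> vanishes y"
        by (simp add: g \<phi>_eq_iff)
      \<comment> \<open>A single factor \<open>?f\<close> suffices as the cancelling power: it turns
        all vanishing monomials into nonfaces, which are identified in the simplicial
        binoid.\<close>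
      moreover have "nonface \<Delta> (Some (mset_set F) \<otimes>\<^bsub>?B\<^esub> x)" if "vanishes x" for x
        using that \<open>finite F\<close> by (cases x) (auto simp: vanishes_def)
      ultimately have "(Some (mset_set F) \<otimes>\<^bsub>?B\<^esub> x, Some (mset_set F) \<otimes>\<^bsub>?B\<^esub> y) \<in> r"
        using xy \<open>F \<subseteq> V\<close> \<open>finite F\<close> by (auto simp: r_iff)
      then have "?f \<otimes>\<^bsub>?M\<^esub> a = ?f \<otimes>\<^bsub>?M\<^esub> b"
        using xy \<open>F \<subseteq> V\<close> \<open>finite F\<close> by (simp add: f M_mult equiv_class_eq[OF r_eq])
      moreover have "?f \<in> powers ?M ?f"
        unfolding powers_def using face_element_closed[OF \<open>F \<subseteq> V\<close>, of \<Delta>]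
        by (intro range_eqI[of _ _ 1]) simp
      ultimately show ?thesis by blast
    qed
    show "\<exists>a \<in> carrier ?M. \<exists>s \<in> powers ?M ?f. y \<otimes>\<^bsub>?N\<^esub> g s = g a" if y: "y \<in> carrier ?N" for y
    proof -
      obtain x z where xz: "x \<in> carrier (free_binoid ?W)" "z \<in> carrier ?Z" "y = \<tau> x z"
        using \<tau>_cases[OF y] by blast
      have "\<exists>w \<in> carrier ?B. \<exists>k. y \<otimes>\<^bsub>?N\<^esub> \<tau> (Some {#}) (Some (c (int k))) = \<phi> w"
      \<comment> \<open>Only the representative \<open>None\<close> is treated apart, with exponent
        0. A monomial \<open>x\<close> with nonface support is covered by the general construction
        in the second case.\<close>
      proof (cases "x = None \<or> z = None")
        case True
        have "x \<otimes>\<^bsub>free_binoid ?W\<^esub> Some {#} = x" by (cases x) auto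
        with True have "y \<otimes>\<^bsub>?N\<^esub> \<tau> (Some {#}) (Some (c (int 0))) = \<phi> None"
          using xz c_closed \<open>x \<otimes>\<^bsub>free_binoid ?W\<^esub> Some {#} = x\<close>
          by (simp add: \<tau>_mult, subst \<phi>_def, subst \<tau>_eq_iff)
            (auto simp: off_face_def face_exponents_def)
        then show ?thesis by (blast intro: free_binoid_simps(1))
      next
        case False
        then obtain m d where x: "x = Some m" and z: "z = Some d" by auto
        with xz have m: "set_mset m \<subseteq> ?W" and d: "d \<in> extensional F" by (auto simp: PiE_def)
        \<comment> \<open>One exponent has to make all entries of \<open>d\<close> nonnegative at
          once; the sum of their absolute values is large enough.\<close>
        define k where "k = (\<Sum>v\<in>F. nat \<bar>d v\<bar>)"
        have pos: "0 \<le> d v + int k" if "v \<in> F" for v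
          using member_le_sum[of v F "\<lambda>v. nat \<bar>d v\<bar>"] that \<open>finite F\<close>
          unfolding k_def[symmetric] by simp
        \<comment> \<open>The monomial on \<open>F\<close> whose exponents are those of
          \<open>d\<close> shifted by \<open>k\<close>. With the link part \<open>m\<close> it forms
          the numerator \<open>m + e\<close>.\<close>
        define e where "e = (\<Sum>v\<in>F. replicate_mset (nat (d v + int k)) v)"
        have count_e: "count e v = (if v \<in> F then nat (d v + int k) else 0)" for v
          using \<open>finite F\<close> by (simp add: e_def count_sum if_distrib sum.delta cong: if_cong)
        then have set_e: "set_mset e \<subseteq> F"
          by (auto simp flip: count_greater_zero_iff split: if_splits)
        have W: "?W \<subseteq> V" "?W \<inter> F = {}" by (auto simp: link_vertices_def)
        have zero: "count m v = 0" if "v \<in> F" for v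
          using that m W by (auto simp: count_eq_zero_iff)
        then have "?e (Some (m + e)) = Some (\<lambda>v\<in>F. d v + int k)"
          by (auto simp: face_exponents_def count_e pos intro!: restrict_ext)
        moreover have "?p (Some (m + e)) = Some m"
        proof -
          have "filter_mset (\<lambda>v. v \<notin> F) m = m" "filter_mset (\<lambda>v. v \<notin> F) e = {#}"
            using zero set_e by (auto intro!: multiset_eqI)
          then show ?thesis using m set_e by (auto simp: off_face_def)
        qed
        moreover have "y \<otimes>\<^bsub>?N\<^esub> \<tau> (Some {#}) (Some (c (int k))) = \<tau> (Some m) (Some (\<lambda>v\<in>F. d v + int k))"
          using xz c_closed x z
          by (simp add: \<tau>_mult) (auto simp: c_def intro!: arg_cong2[of _ _ _ _ \<tau>] restrict_ext)
        ultimately have "y \<otimes>\<^bsub>?N\<^esub> \<tau> (Some {#}) (Some (c (int k))) = \<phi> (Some (m + e))"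
          by (simp add: \<phi>_def)
        then show ?thesis
          using m W set_e \<open>F \<subseteq> V\<close> by (intro bexI[of _ "Some (m + e)"] exI) auto
      qed
      then obtain w k where w: "w \<in> carrier ?B"
        "y \<otimes>\<^bsub>?N\<^esub> \<tau> (Some {#}) (Some (c (int k))) = \<phi> w" by blast
      moreover have "g (?f [^]\<^bsub>?M\<^esub> k) = \<tau> (Some {#}) (Some (c (int k)))"
        unfolding f_pow using \<open>F \<subseteq> V\<close> supp_pow[of k] by (subst g) (auto simp: \<phi>_pow)
      ultimately show ?thesis
        by (intro bexI[of _ "r `` {w}"] bexI[of _ "?f [^]\<^bsub>?M\<^esub> k"])
          (auto simp: g M_carrier powers_def intro: quotientI)
    qed
  qed unfold_locales
qed

theorem theorem2p33:
  fixes n :: nat and \<Delta> :: "nat set set" and F :: "nat set"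
  assumes "simplicial_complex {1..n} \<Delta>" and "F \<in> \<Delta>"
  shows "localization (simplicial_binoid {1..n} \<Delta>) (face_element {1..n} \<Delta> F)
    \<cong>\<^sub>b simplicial_binoid (link_vertices {1..n} \<Delta> F) (link \<Delta> F)
        \<and>\<^sub>b adjoin_absorbing (product_group F (\<lambda>_. integer_group))"
  using assms by (intro localization_at_face) simp

end
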